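(* Let $M$ be a synergy graph on a finite set of workers $N$, and let $G=\langle N,K,v_M\rangle$ be the symmetric competition game with two firms ($|K|=2$), both of which have the value function $v_M$. Then $G$ has a PSPE.
   Context: Competition game: $N$ is a finite set of workers, $K$ a finite set of $k\ge 2$ firms, and each firm $i\in K$ has a nondecreasing value function $v_i:2^N\to\mathbb R_+$ with $v_i(\emptyset)=0$. In step 1 all firms simultaneously choose payment policies $\mathbf x_i=(x_{ij})_{j\in N}\in\mathbb R^N$ (payments may be negative). In step 2 each worker chooses a firm or stays idle. An outcome is a pair $(P,\mathbf X)$ where $\mathbf X=(x_{ij})$ and $P=(S_0,(S_i)_{i\in K})$ is a partition of $N$ ($S_0$ = idle workers; parts may be empty). Put $x_{0j}=0$. A worker $j\in S_i$ receives $\hat x_j=x_{ij}$; firm $i$ has profit $r_i(P,\mathbf X)=v_i(S_i)-\sum_{j\in S_i}x_{ij}$. The game is symmetric if all $v_i$ are equal. PSPE: let $\mathcal P(\mathbf X)$ be the set of partitions such that every worker $j\in S_i$ ($i\in K\cup\{0\}$) satisfies $x_{ij}=\max_{i'\in K\cup\{0\}}x_{i'j}$. A tie-breaking rule is a map $\mathbf X\mapsto P(\mathbf X)\in\mathcal P(\mathbf X)$. An outcome $(P,\mathbf X)$ is a pure subgame perfect equilibrium (PSPE) if for some tie-breaking rule: (a) $P=P(\mathbf X)$; and (b) for every $i\in K$ and every policy $\mathbf x_i'$, $r_i(P',\mathbf X')\le r_i(P,\mathbf X)$, where $\mathbf X'=(\mathbf x_{-i},\mathbf x_i')$ and $P'=P(\mathbf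 X')$. Synergy graph: an undirected graph on $N$ with nonnegative edge weights, self-edges allowed, represented by a symmetric nonnegative matrix $M$ indexed by $N\times N$. Its value function is (for a fixed linear order on $N$) $$v_M(S)=\sum_{j\in S}M(j,j)+\sum_{j,j'\in S,\ j<j'}M(j,j')+\sum_{j\in S}\sum_{j''\notin S}M(j,j'').$$ *)

theory Defs
  imports Complex_Main "HOL-Library.FuncSet" "HOL-Library.Disjoint_Sets"
begin

text \<open>
  The choices open to a worker: \<open>Some i\<close> is the firm \<open>i\<close> and \<open>None\<close> is the idle option,
  the index \<open>0\<close> of \<open>S\<^sub>0\<close> and \<open>x\<^sub>0\<close>.
\<close>

definition choices :: "'k set \<Rightarrow> 'k option set" where
  "choices K = insert None (Some ` K)"

text \<open>
  Policies, policy profiles and partitions are extensional functions, so that each is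
  determined by its values on the workers and firms of the game. In particular a
  tie-breaking rule cannot depend on values outside of \<open>N\<close> and \<open>K\<close>.
\<close>

definition policies :: "'w set \<Rightarrow> ('w \<Rightarrow> real) set" where
  "policies N = N \<rightarrow>\<^sub>E UNIV"

definition profiles :: "'w set \<Rightarrow> 'k set \<Rightarrow> ('k \<Rightarrow> 'w \<Rightarrow> real) set" where
  "profiles N K = K \<rightarrow>\<^sub>E policies N"

definition partitions :: "'w set \<Rightarrow> 'k set \<Rightarrow> ('k option \<Rightarrow> 'w set) set" where
  "partitions N K = {P \<in> choices K \<rightarrow>\<^sub>E Pow N.
     disjoint_family_on P (choices K) \<and> (\<Union>c\<in>choices K. P c) = N}"

fun payment :: "('k \<Rightarrow> 'w \<Rightarrow> real) \<Rightarrow> 'k option \<Rightarrow> 'w \<Rightarrow> real" where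
  "payment X None j = 0"
| "payment X (Some i) j = X i j"

definition best_response_partitions ::
  "'w set \<Rightarrow> 'k set \<Rightarrow> ('k \<Rightarrow> 'w \<Rightarrow> real) \<Rightarrow> ('k option \<Rightarrow> 'w set) set" where
  "best_response_partitions N K X = {P \<in> partitions N K.
     \<forall>c\<in>choices K. \<forall>j\<in>P c. payment X c j = Max ((\<lambda>c'. payment X c' j) ` choices K)}"

definition profit ::
  "('k \<Rightarrow> 'w set \<Rightarrow> real) \<Rightarrow> ('k option \<Rightarrow> 'w set) \<Rightarrow> ('k \<Rightarrow> 'w \<Rightarrow> real) \<Rightarrow> 'k \<Rightarrow> real" where
  "profit v P X i = v i (P (Some i)) - (\<Sum>j\<in>P (Some i). X i j)"

definition tie_breaking_rule ::
  "'w set \<Rightarrow> 'k set \<Rightarrow> (('k \<Rightarrow> 'w \<Rightarrow> real) \<Rightarrow> ('k option \<Rightarrow> 'w set)) \<Rightarrow> bool" where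
  "tie_breaking_rule N K \<tau> \<longleftrightarrow> (\<forall>X\<in>profiles N K. \<tau> X \<in> best_response_partitions N K X)"

definition PSPE ::
  "'w set \<Rightarrow> 'k set \<Rightarrow> ('k \<Rightarrow> 'w set \<Rightarrow> real) \<Rightarrow>
   ('k option \<Rightarrow> 'w set) \<Rightarrow> ('k \<Rightarrow> 'w \<Rightarrow> real) \<Rightarrow> bool" where
  "PSPE N K v P X \<longleftrightarrow> P \<in> partitions N K \<and> X \<in> profiles N K \<and>
     (\<exists>\<tau>. tie_breaking_rule N K \<tau> \<and> P = \<tau> X \<and>
       (\<forall>i\<in>K. \<forall>x\<in>policies N. profit v (\<tau> (X(i := x))) (X(i := x)) i \<le> profit v P X i))"

locale competition_game =
  fixes N :: "'w set" and K :: "'k set" and v :: "'k \<Rightarrow> 'w set \<Rightarrow> real"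
  assumes finite_workers: "finite N"
    and finite_firms: "finite K"
    and two_firms: "card K \<ge> 2"
    and value_nonneg: "\<And>i S. i \<in> K \<Longrightarrow> S \<subseteq> N \<Longrightarrow> 0 \<le> v i S"
    and value_mono: "\<And>i S T. i \<in> K \<Longrightarrow> S \<subseteq> T \<Longrightarrow> T \<subseteq> N \<Longrightarrow> v i S \<le> v i T"
    and value_empty: "\<And>i. i \<in> K \<Longrightarrow> v i {} = 0"

definition synergy_graph :: "'w set \<Rightarrow> ('w \<Rightarrow> 'w \<Rightarrow> real) \<Rightarrow> bool" where
  "synergy_graph N M \<longleftrightarrow> (\<forall>j\<in>N. \<forall>j'\<in>N. M j j' = M j' j \<and> 0 \<le> M j j')"

text \<open>
  The reflexive linear order \<open>r\<close> on \<open>N\<close> serves to count each edge inside \<open>S\<close> once;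
  \<open>j < j'\<close> is \<open>(j, j') \<in> r - Id\<close>.
\<close>

definition synergy_value ::
  "'w set \<Rightarrow> ('w \<times> 'w) set \<Rightarrow> ('w \<Rightarrow> 'w \<Rightarrow> real) \<Rightarrow> 'w set \<Rightarrow> real" where
  "synergy_value N r M S =
     (\<Sum>j\<in>S. M j j)
   + (\<Sum>(j, j') \<in> {(j, j'). j \<in> S \<and> j' \<in> S \<and> (j, j') \<in> r - Id}. M j j')
   + (\<Sum>j\<in>S. \<Sum>j''\<in>N - S. M j j'')"

lemma synergy_value_insert_ge:
  assumes "finite N" "linear_order_on N r" "synergy_graph N M"
    and a: "a \<in> N" "a \<notin> S" and S: "S \<subseteq> N"
  shows "synergy_value N r M S \<le> synergy_value N r M (insert a S)"
proof -
  have fS: "finite S" using assms finite_subset by blast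
  have sym: "\<And>j j'. j \<in> N \<Longrightarrow> j' \<in> N \<Longrightarrow> M j j' = M j' j"
    and nn: "\<And>j j'. j \<in> N \<Longrightarrow> j' \<in> N \<Longrightarrow> 0 \<le> M j j'"
    using assms(3) by (auto simp: synergy_graph_def)
  have tot: "\<And>j. j \<in> S \<Longrightarrow> (a, j) \<in> r \<or> (j, a) \<in> r"
    and anti: "\<And>x y. (x, y) \<in> r \<Longrightarrow> (y, x) \<in> r \<Longrightarrow> x = y"
    using assms(2) a S
    by (auto simp: linear_order_on_def partial_order_on_def total_on_def antisym_def)
  let ?E = "\<lambda>S. {(j, j'). j \<in> S \<and> j' \<in> S \<and> (j, j') \<in> r - Id}"
  let ?L = "{j \<in> S. (a, j) \<in> r}" and ?G = "{j \<in> S. (a, j) \<notin> r}"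
  have split: "?E (insert a S) = ?E S \<union> (Pair a ` ?L \<union> (\<lambda>j. (j, a)) ` ?G)"
    using tot anti a by auto
  have fE: "finite (?E S)"
    by (rule finite_subset[of _ "S \<times> S"]) (use fS in auto)
  have "(\<Sum>(j, j')\<in>?E (insert a S). M j j')
      = (\<Sum>(j, j')\<in>?E S. M j j') + ((\<Sum>j\<in>?L. M a j) + (\<Sum>j\<in>?G. M j a))"
    unfolding split
    apply (subst sum.union_disjoint)
    using fE fS a apply (auto)[3]
    apply (subst sum.union_disjoint)
    using fS a apply (auto)[3]
    apply (simp add: sum.reindex inj_on_def)
    done
  also have "(\<Sum>j\<in>?G. M j a) = (\<Sum>j\<in>?G. M a j)"
    using sym a S by (intro sum.cong) auto
  also have "(\<Sum>j\<in>?L. M a j) + (\<Sum>j\<in>?G. M a j) = (\<Sum>j\<in>S. M a j)"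
    using fS by (subst sum.union_disjoint[symmetric]) (auto intro: sum.cong)
  finally have E: "(\<Sum>(j, j')\<in>?E (insert a S). M j j')
      = (\<Sum>(j, j')\<in>?E S. M j j') + (\<Sum>j\<in>S. M a j)" .
  have N: "N - S = insert a (N - insert a S)" using a by auto
  have "(\<Sum>j\<in>S. \<Sum>j''\<in>N - S. M j j'') = (\<Sum>j\<in>S. M j a + (\<Sum>j''\<in>N - insert a S. M j j''))"
    unfolding N using assms(1) by (intro sum.cong) auto
  also have "\<dots> = (\<Sum>j\<in>S. M j a) + (\<Sum>j\<in>S. \<Sum>j''\<in>N - insert a S. M j j'')"
    by (rule sum.distrib)
  also have "(\<Sum>j\<in>S. M j a) = (\<Sum>j\<in>S. M a j)"
    using sym a S by (intro sum.cong) auto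
  finally have C: "(\<Sum>j\<in>S. \<Sum>j''\<in>N - S. M j j'')
      = (\<Sum>j\<in>S. M a j) + (\<Sum>j\<in>S. \<Sum>j''\<in>N - insert a S. M j j'')" .
  have "0 \<le> M a a" "0 \<le> (\<Sum>j''\<in>N - insert a S. M a j'')"
    using nn a by (auto intro: sum_nonneg)
  with E C show ?thesis
    using fS a unfolding synergy_value_def by simp
qed

lemma competition_game_synergy:
  assumes "finite N" "linear_order_on N r" "synergy_graph N M" "card K = 2"
  shows "competition_game N K (\<lambda>_. synergy_value N r M)"
proof -
  have mono: "synergy_value N r M S \<le> synergy_value N r M T" if "S \<subseteq> T" "T \<subseteq> N" for S T
  proof -
    have fin: "finite (T - S)" using that assms(1) finite_subset by blast
    have "D \<subseteq> T - S \<Longrightarrow> synergy_value N r M S \<le> synergy_value N r M (S \<union> D)"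
      if D: "finite D" for D
      using D
    proof (induction D rule: finite_induct)
      case (insert a D)
      have "synergy_value N r M (S \<union> D) \<le> synergy_value N r M (insert a (S \<union> D))"
        using insert \<open>S \<subseteq> T\<close> \<open>T \<subseteq> N\<close> assms by (intro synergy_value_insert_ge) auto
      with insert show ?case by simp
    qed simp
    from this[of "T - S"] fin \<open>S \<subseteq> T\<close> show ?thesis
      by (simp add: Un_absorb1)
  qed
  have empty: "synergy_value N r M {} = 0" by (simp add: synergy_value_def)
  have "0 \<le> synergy_value N r M S" if "S \<subseteq> N" for S
    using mono[of "{}" S] that empty by simp
  moreover have "finite K" using assms(4) card.infinite by fastforce
  ultimately show ?thesis using assms mono empty by unfold_locales auto
qed

end

theory Submission
  imports Defs
begin

text \<open>
  Let both firms offer each worker \<open>j\<close> the payment \<open>p j\<close> consisting of the self-edge at \<open>j\<close> and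
  half of the other edges at \<open>j\<close>. Then the profit from hiring \<open>S\<close> at these payments is half of the
  weight of the cut between \<open>S\<close> and \<open>N - S\<close>, which is symmetric in \<open>S\<close> and \<open>N - S\<close>. So if \<open>S\<close>
  is a maximum cut, then \<open>S\<close> and \<open>N - S\<close> both maximise the profit at \<open>p\<close>. A deviating firm
  has to pay at least \<open>p j\<close> to every worker \<open>j\<close> that it attracts, hence cannot gain.
\<close>

definition half_degree :: "'w set \<Rightarrow> ('w \<Rightarrow> 'w \<Rightarrow> real) \<Rightarrow> 'w \<Rightarrow> real" where
  "half_degree N M j = M j j + (\<Sum>j'\<in>N - {j}. M j j') / 2"

definition cut_weight :: "'w set \<Rightarrow> ('w \<Rightarrow> 'w \<Rightarrow> real) \<Rightarrow> 'w set \<Rightarrow> real" where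
  "cut_weight N M S = (\<Sum>j\<in>S. \<Sum>j'\<in>N - S. M j j')"

text \<open>Totality and antisymmetry of \<open>r\<close> split the pairs of distinct workers of
  \<open>S\<close> into the strict order and its converse, which have equal sums because
  \<open>M\<close> is symmetric. This removes \<open>r\<close> from all later computations.\<close>

lemma sum_ordered_pairs:
  fixes M :: "'w \<Rightarrow> 'w \<Rightarrow> real"
  assumes "finite S" "linear_order_on N r" "S \<subseteq> N"
    and sym: "\<And>j j'. j \<in> S \<Longrightarrow> j' \<in> S \<Longrightarrow> M j j' = M j' j"
  shows "2 * (\<Sum>(j, j')\<in>{(j, j'). j \<in> S \<and> j' \<in> S \<and> (j, j') \<in> r - Id}. M j j')
    = (\<Sum>j\<in>S. \<Sum>j'\<in>S - {j}. M j j')"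
proof -
  let ?E = "{(j, j'). j \<in> S \<and> j' \<in> S \<and> (j, j') \<in> r - Id}"
  have tot: "\<And>x y. x \<in> S \<Longrightarrow> y \<in> S \<Longrightarrow> x \<noteq> y \<Longrightarrow> (x, y) \<in> r \<or> (y, x) \<in> r"
    and anti: "\<And>x y. (x, y) \<in> r \<Longrightarrow> (y, x) \<in> r \<Longrightarrow> x = y"
    using assms(2,3)
    unfolding linear_order_on_def partial_order_on_def total_on_def antisym_def by blast+
  have fE: "finite ?E"
    by (rule finite_subset[of _ "S \<times> S"]) (use assms(1) in auto)
  have conv: "(\<Sum>(j, j')\<in>?E\<inverse>. M j j') = (\<Sum>(j, j')\<in>?E. M j j')"
    by (rule sum.reindex_bij_witness[of _ prod.swap prod.swap]) (auto simp: sym)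
  have "Sigma S (\<lambda>j. S - {j}) = ?E \<union> ?E\<inverse>"
    using tot by auto
  moreover have "?E \<inter> ?E\<inverse> = {}"
    using anti by auto
  ultimately have "(\<Sum>(j, j')\<in>Sigma S (\<lambda>j. S - {j}). M j j')
      = (\<Sum>(j, j')\<in>?E. M j j') + (\<Sum>(j, j')\<in>?E\<inverse>. M j j')"
    using fE by (simp only: sum.union_disjoint finite_converse)
  then show ?thesis
    using conv assms(1) by (simp add: sum.Sigma)
qed

text \<open>Self-edges and edges inside \<open>S\<close> are paid out in full, the latter half at
  each end. An edge leaving \<open>S\<close> counts fully in the value but is paid for only at its
  end in \<open>S\<close>, so half of it remains.\<close>

lemma synergy_value_minus_half_degree:
  assumes "finite N" "linear_order_on N r" "synergy_graph N M" "S \<subseteq> N"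
  shows "synergy_value N r M S - (\<Sum>j\<in>S. half_degree N M j) = cut_weight N M S / 2"
proof -
  have fS: "finite S" using assms finite_subset by blast
  have "(\<Sum>j'\<in>N - {j}. M j j') = (\<Sum>j'\<in>S - {j}. M j j') + (\<Sum>j'\<in>N - S. M j j')" if "j \<in> S" for j
  proof -
    have "N - {j} = (S - {j}) \<union> (N - S)" using that assms(4) by auto
    then show ?thesis using fS assms(1) by (auto intro: sum.union_disjoint)
  qed
  then have "(\<Sum>j\<in>S. half_degree N M j) = (\<Sum>j\<in>S. M j j)
      + ((\<Sum>j\<in>S. \<Sum>j'\<in>S - {j}. M j j') + cut_weight N M S) / 2"
    by (simp add: half_degree_def cut_weight_def sum.distrib sum_divide_distrib[symmetric])
  moreover have "2 * (\<Sum>(j, j')\<in>{(j, j'). j \<in> S \<and> j' \<in> S \<and> (j, j') \<in> r - Id}. M j j')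
      = (\<Sum>j\<in>S. \<Sum>j'\<in>S - {j}. M j j')"
    using assms fS by (intro sum_ordered_pairs) (auto simp: synergy_graph_def)
  ultimately show ?thesis
    unfolding synergy_value_def cut_weight_def by argo
qed

lemma cut_weight_complement:
  assumes "synergy_graph N M" "S \<subseteq> N"
  shows "cut_weight N M (N - S) = cut_weight N M S"
proof -
  have "cut_weight N M (N - S) = (\<Sum>j\<in>N - S. \<Sum>j'\<in>S. M j j')"
    using assms(2) by (simp add: cut_weight_def double_diff)
  also have "\<dots> = (\<Sum>j'\<in>S. \<Sum>j\<in>N - S. M j j')"
    by (rule sum.swap)
  also have "\<dots> = cut_weight N M S"
    unfolding cut_weight_def using assms by (intro sum.cong) (auto simp: synergy_graph_def)
  finally show ?thesis .
qed

lemma finite_choices: "finite K \<Longrightarrow> finite (choices K)"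
  by (simp add: choices_def)

text \<open>A tie-breaking rule must be defined at every profile; this lets one be chosen off the
  equilibrium path.\<close>

lemma best_response_partitions_nonempty:
  assumes "finite K"
  shows "best_response_partitions N K X \<noteq> {}"
proof -
  have fin: "finite (choices K)" and ne: "choices K \<noteq> {}"
    using assms by (auto simp: finite_choices choices_def)
  have "\<exists>c\<in>choices K. payment X c j = Max ((\<lambda>c'. payment X c' j) ` choices K)" for j
    using Max_in[of "(\<lambda>c'. payment X c' j) ` choices K"] fin ne by fastforce
  then obtain f where f: "\<And>j. f j \<in> choices K"
      "\<And>j. payment X (f j) j = Max ((\<lambda>c'. payment X c' j) ` choices K)"
    by metis
  \<comment> \<open>The parts are the fibres of \<open>f\<close>, which selects one best choice for
    each worker.\<close>
  have "(\<lambda>c\<in>choices K. {j \<in> N. f j = c}) \<in> best_response_partitions N K X"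
    using f by (auto simp: best_response_partitions_def partitions_def disjoint_family_on_def)
  then show ?thesis by blast
qed

lemma best_response_payment_le:
  assumes "finite K" "P \<in> best_response_partitions N K X"
    and "c \<in> choices K" "j \<in> P c" "c' \<in> choices K"
  shows "payment X c' j \<le> payment X c j"
proof -
  have "payment X c j = Max ((\<lambda>c'. payment X c' j) ` choices K)"
    using assms by (auto simp: best_response_partitions_def)
  also have "\<dots> \<ge> payment X c' j"
    using assms by (intro Max_ge) (auto simp: finite_choices)
  finally show ?thesis .
qed

text \<open>The value functions are arbitrary here: \<open>P\<close> and \<open>p\<close> form a
  Walrasian equilibrium in which everyone is hired, with \<open>opt\<close> saying that each firm
  receives a demanded set at the prices \<open>p\<close>.\<close>

lemma PSPE_common_payments:
  assumes "finite K" "card K \<ge> 2"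
    and p: "\<And>j. j \<in> N \<Longrightarrow> 0 \<le> p j"
    and P: "P \<in> partitions N K" "P None = {}"
    and opt: "\<And>i T. i \<in> K \<Longrightarrow> T \<subseteq> N \<Longrightarrow>
      v i T - sum p T \<le> v i (P (Some i)) - sum p (P (Some i))"
  shows "PSPE N K v P (\<lambda>i\<in>K. \<lambda>j\<in>N. p j)"
proof -
  define X where "X = (\<lambda>i\<in>K. \<lambda>j\<in>N. p j)"
  have X: "X \<in> profiles N K"
    by (auto simp: X_def profiles_def policies_def)
  have PN: "P c \<subseteq> N" if "c \<in> choices K" for c
    using P that by (auto simp: partitions_def)
  have best: "P \<in> best_response_partitions N K X"
  proof -
    have "payment X c j = Max ((\<lambda>c'. payment X c' j) ` choices K)"
      if c: "c \<in> choices K" and j: "j \<in> P c" for c j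
    proof -
      have "j \<in> N" using PN c j by blast
      moreover obtain i where "c = Some i" "i \<in> K"
        using c j P by (auto simp: choices_def)
      ultimately have "payment X c' j \<le> payment X c j" if "c' \<in> choices K" for c'
        using that p by (auto simp: choices_def X_def)
      then show ?thesis
        using c finite_choices[OF assms(1)] by (intro Max_eqI[symmetric]) blast+
    qed
    then show ?thesis using P by (simp add: best_response_partitions_def)
  qed
  \<comment> \<open>Only the value at \<open>X\<close> is prescribed. Elsewhere any best response
    will do, since the bound on a deviator's profit below does not depend on how ties are
    broken.\<close>
  define \<tau> where "\<tau> = (\<lambda>Y. if Y = X then P else SOME Q. Q \<in> best_response_partitions N K Y)"
  have \<tau>: "\<tau> Y \<in> best_response_partitions N K Y" for Y
    using best best_response_partitions_nonempty[OF assms(1), of N Y]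
    by (auto simp: \<tau>_def some_in_eq)
  have "profit v (\<tau> (X(i := x))) (X(i := x)) i \<le> profit v P X i" if i: "i \<in> K" for i x
  proof -
    define T where "T = \<tau> (X(i := x)) (Some i)"
    have si: "Some i \<in> choices K" using i by (simp add: choices_def)
    then have TN: "T \<subseteq> N"
      using \<tau>[of "X(i := x)"] by (auto simp: T_def best_response_partitions_def partitions_def)
    \<comment> \<open>A second firm still offers \<open>p j\<close> after the deviation, so every
      worker \<open>j\<close> in \<open>T\<close> must be paid at least that by
      \<open>i\<close>.\<close>
    have "\<not> K \<subseteq> {i}"
      using assms(2) card_mono[of "{i}" K] by auto
    then obtain i' where i': "i' \<in> K" "i' \<noteq> i"
      by blast
    have "p j \<le> x j" if "j \<in> T" for j
      using best_response_payment_le[OF assms(1) \<tau> si that[unfolded T_def], of "Some i'"]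
        i' that TN by (auto simp: choices_def X_def)
    then have "sum p T \<le> sum x T" by (rule sum_mono)
    then have "profit v (\<tau> (X(i := x))) (X(i := x)) i \<le> v i T - sum p T"
      by (simp add: profit_def T_def)
    also have "\<dots> \<le> v i (P (Some i)) - sum p (P (Some i))"
      using opt i TN by blast
    also have "\<dots> = profit v P X i"
      using i PN[OF si] by (auto simp: profit_def X_def intro!: sum.cong)
    finally show ?thesis .
  qed
  moreover have "tie_breaking_rule N K \<tau>" "P = \<tau> X"
    using \<tau> by (auto simp: tie_breaking_rule_def) (simp add: \<tau>_def)
  ultimately show ?thesis
    unfolding PSPE_def X_def[symmetric] using P X by blast
qed

theorem theorem5p2:
  fixes N :: "'w set" and K :: "'k set"
    and M :: "'w \<Rightarrow> 'w \<Rightarrow> real" and r :: "('w \<times> 'w) set"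
  assumes "finite N"
    and "finite K" and "card K = 2"
    and "linear_order_on N r"
    and "synergy_graph N M"
  shows "\<exists>P X. PSPE N K (\<lambda>_. synergy_value N r M) P X"
proof -
  obtain a b where K: "K = {a, b}" "a \<noteq> b"
    using assms(3) by (auto simp: card_2_iff)
  have "Max (cut_weight N M ` Pow N) \<in> cut_weight N M ` Pow N"
    using assms(1) by (intro Max_in) auto
  then obtain S where S: "S \<subseteq> N" "cut_weight N M S = Max (cut_weight N M ` Pow N)"
    by auto
  then have max: "cut_weight N M T \<le> cut_weight N M S" if "T \<subseteq> N" for T
    using assms(1) that by simp
  define P where
    "P = (\<lambda>c\<in>choices K. if c = Some a then S else if c = Some b then N - S else {})"
  have P: "P None = {}" "P (Some a) = S" "P (Some b) = N - S"
    using K by (auto simp: P_def choices_def)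
  have "P \<in> choices K \<rightarrow>\<^sub>E Pow N"
    using S by (auto simp: P_def)
  then have "P \<in> partitions N K"
    using K S P by (auto simp: partitions_def disjoint_family_on_def choices_def)
  moreover have "0 \<le> half_degree N M j" if "j \<in> N" for j
    using assms(5) that by (auto simp: half_degree_def synergy_graph_def intro!: add_nonneg_nonneg sum_nonneg)
  moreover have "synergy_value N r M T - sum (half_degree N M) T
      \<le> synergy_value N r M (P (Some i)) - sum (half_degree N M) (P (Some i))"
    if i: "i \<in> K" and T: "T \<subseteq> N" for i T
  proof -
    \<comment> \<open>Both firms hold a side of the same maximum cut, so one bound serves for each
      of them.\<close>
    have "P (Some i) \<subseteq> N" "cut_weight N M (P (Some i)) = cut_weight N M S"
      using i K S P cut_weight_complement[OF assms(5) S(1)] by auto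
    then show ?thesis
      using max[OF T] T assms by (simp add: synergy_value_minus_half_degree)
  qed
  ultimately show ?thesis
    using PSPE_common_payments[where P = P and p = "half_degree N M" and N = N and K = K
        and v = "\<lambda>_. synergy_value N r M"] assms(2,3) P(1) by auto
qed

end
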